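(* Let $D$ be a domain. Then $D$ is a $D$-ring if and only if $D$ satisfies the degree polynomial property (DPP).
   Context: "Domain" means (commutative) integral domain. Convention: $\deg 0=-\infty$. "For almost all $k\in D$" means for all but finitely many $k\in D$. Let $K$ be the quotient field of $D$. - $D$ is a $D$-ring if for all $f(x),g(x)\in D[x]$ with $g\neq 0$: if $g(k)\mid f(k)$ in $D$ for almost all $k\in D$, then $\frac{f(x)}{g(x)}\in K[x]$. - $D$ satisfies DPP if for all $f(x),g(x)\in D[x]$: if for all $k\in D$ ($g(k)\neq 0\Rightarrow g(k)\mid f(k)$), then $f(x)=0$ or $\deg f(x)\ge \deg g(x)$. *)

theory Defs
  imports "HOL-Computational_Algebra.Computational_Algebra"
begin

text \<open>
  The domain \<open>D\<close> is the type \<open>'a::idom\<close>, with quotient field \<open>K\<close> being \<open>'a fract\<close>.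
  The quotient \<open>f/g\<close> is formed in \<open>K(x)\<close>, represented by \<open>'a fract poly fract\<close>;
  lying in \<open>K[x]\<close> means lying in the image of the embedding \<open>K[x] \<rightarrow> K(x)\<close>.
\<close>

definition rat_quot :: "'a::idom poly \<Rightarrow> 'a poly \<Rightarrow> 'a fract poly fract" where
  "rat_quot f g = to_fract (map_poly to_fract f) / to_fract (map_poly to_fract g)"

definition D_ring :: "'a::idom itself \<Rightarrow> bool" where
  "D_ring _ \<longleftrightarrow>
     (\<forall>f g :: 'a poly. g \<noteq> 0 \<longrightarrow>
        finite {k. \<not> poly g k dvd poly f k} \<longrightarrow>
        rat_quot f g \<in> range (to_fract :: 'a fract poly \<Rightarrow> _))"

text \<open>
  The intended convention is \<open>deg 0 = -\<infinity>\<close>, whereas \<^term>\<open>degree 0 = (0::nat)\<close>. The two agree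
  here: for \<open>f \<noteq> 0\<close> and \<open>g = 0\<close> the inequality holds under both conventions.
\<close>

definition DPP :: "'a::idom itself \<Rightarrow> bool" where
  "DPP _ \<longleftrightarrow>
     (\<forall>f g :: 'a poly.
        (\<forall>k. poly g k \<noteq> 0 \<longrightarrow> poly g k dvd poly f k) \<longrightarrow>
        f = 0 \<or> degree f \<ge> degree g)"

end

theory Submission
  imports Defs
begin

text \<open>
  A rational function \<open>f/g\<close> is a polynomial over the quotient field \<open>K\<close> exactly when \<open>g\<close> divides
  \<open>f\<close> in \<open>K[x]\<close>.

  Assume the D-ring property. A nonzero \<open>g\<close> has only finitely many roots, so divisibility of
  values at all non-roots is divisibility almost everywhere; hence \<open>g\<close> divides \<open>f\<close> in \<open>K[x]\<close>, and
  comparing degrees there gives \<open>f = 0\<close> or \<open>degree f \<ge> degree g\<close>.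

  Assume DPP. Pseudo-division gives \<open>c f = g q + r\<close> with \<open>c \<noteq> 0\<close> and \<open>r = 0\<close> or
  \<open>degree r < degree g\<close>, all over \<open>D\<close>. Wherever \<open>g(k)\<close> divides \<open>f(k)\<close> it also divides \<open>r(k)\<close>. The
  finitely many remaining places are repaired by multiplying \<open>r\<close> by the product of the nonzero
  values of \<open>g\<close> there (\<open>smult_dvd_at_nonroots\<close>); this constant does not change the degree, so DPP
  forces \<open>r = 0\<close>. As \<open>c\<close> is invertible in \<open>K\<close>, the quotient \<open>f/g\<close> lies in \<open>K[x]\<close>.
\<close>

lemma rat_quot_in_range_iff:
  fixes f g :: "'a::idom poly"
  assumes "g \<noteq> 0"
  shows "rat_quot f g \<in> range to_fract \<longleftrightarrow> fract_poly g dvd fract_poly f"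
proof -
  have "to_fract (fract_poly g) \<noteq> 0"
    using assms by simp
  hence "rat_quot f g = to_fract p \<longleftrightarrow> fract_poly f = fract_poly g * p" for p
    by (simp add: rat_quot_def divide_eq_eq mult.commute flip: to_fract_mult)
  thus ?thesis
    by (auto simp: image_iff dvd_def)
qed

text \<open>
  The finite exceptional set costs only a constant factor, namely the product of the nonzero
  values that \<open>g\<close> takes on it.
\<close>

lemma smult_dvd_at_nonroots:
  fixes g r :: "'a::idom poly"
  assumes "finite {k. \<not> poly g k dvd poly r k}"
  obtains d where "d \<noteq> 0" and "\<And>k. poly g k \<noteq> 0 \<Longrightarrow> poly g k dvd poly (smult d r) k"
proof -
  define E where "E = {k. \<not> poly g k dvd poly r k \<and> poly g k \<noteq> 0}"
  have "finite E"
    using assms by (rule rev_finite_subset) (auto simp: E_def)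
  show thesis
  proof
    show "(\<Prod>k\<in>E. poly g k) \<noteq> 0"
      using \<open>finite E\<close> by (simp add: E_def)
    fix k assume "poly g k \<noteq> 0"
    show "poly g k dvd poly (smult (\<Prod>k\<in>E. poly g k) r) k"
    proof (cases "k \<in> E")
      case True
      thus ?thesis
        using \<open>finite E\<close> by (simp add: dvd_prodI)
    next
      case False
      thus ?thesis
        using \<open>poly g k \<noteq> 0\<close> by (simp add: E_def)
    qed
  qed
qed

theorem proposition3p4:
  shows "D_ring TYPE('a::idom) \<longleftrightarrow> DPP TYPE('a)"
proof
  assume D: "D_ring TYPE('a)"
  show "DPP TYPE('a)"
    unfolding DPP_def
  proof (intro allI impI)
    fix f g :: "'a poly"
    assume dvd: "\<forall>k. poly g k \<noteq> 0 \<longrightarrow> poly g k dvd poly f k"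
    show "f = 0 \<or> degree f \<ge> degree g"
    proof (cases "g = 0")
      case False
      have "finite {k. poly g k = 0}"
        using False by (rule poly_roots_finite)
      hence "finite {k. \<not> poly g k dvd poly f k}"
        by (rule rev_finite_subset) (use dvd in auto)
      with D False have "rat_quot f g \<in> range to_fract"
        by (simp add: D_ring_def)
      with False have "fract_poly g dvd fract_poly f"
        by (simp add: rat_quot_in_range_iff)
      thus ?thesis
        using dvd_imp_degree_le[of "fract_poly g" "fract_poly f"] by (auto simp: degree_map_poly)
    qed simp
  qed
next
  assume DPP: "DPP TYPE('a)"
  show "D_ring TYPE('a)"
    unfolding D_ring_def
  proof (intro allI impI)
    fix f g :: "'a poly"
    assume g: "g \<noteq> 0" and fin: "finite {k. \<not> poly g k dvd poly f k}"
    define r where "r = pseudo_mod f g"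
    obtain c q where "c \<noteq> 0" and cf: "smult c f = g * q + r"
      using pseudo_mod(1)[OF g, of f] by (auto simp: r_def)
    have r: "poly r k = c * poly f k - poly g k * poly q k" for k
      using arg_cong[OF cf, of "\<lambda>p. poly p k"] by simp
    have "finite {k. \<not> poly g k dvd poly r k}"
      using fin by (rule rev_finite_subset) (auto simp: r)
    then obtain d where "d \<noteq> 0"
      and "\<And>k. poly g k \<noteq> 0 \<Longrightarrow> poly g k dvd poly (smult d r) k"
      using smult_dvd_at_nonroots by blast
    hence "smult d r = 0 \<or> degree (smult d r) \<ge> degree g"
      using DPP by (simp only: DPP_def) blast
    hence "r = 0"
      using \<open>d \<noteq> 0\<close> pseudo_mod(2)[OF g, of f] by (auto simp: r_def)
    hence "smult (to_fract c) (fract_poly f) = fract_poly g * fract_poly q"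
      using arg_cong[OF cf, of fract_poly] by simp
    hence "fract_poly g dvd smult (to_fract c) (fract_poly f)"
      by simp
    hence "fract_poly g dvd fract_poly f"
      using \<open>c \<noteq> 0\<close> by (simp add: dvd_smult_iff)
    with g show "rat_quot f g \<in> range to_fract"
      by (simp add: rat_quot_in_range_iff)
  qed
qed

end
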